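(* Let $X(u,v)=(f(u)\cos\alpha v,f(u)\sin\alpha v,g(u)\cos\beta v,g(u)\sin\beta v)$ be a general rotational surface in $\mathbb R^4$ whose meridians lie in two-dimensional planes, with rates of rotation $\alpha,\beta>0$ and meridian parametrized by arc-length. The Gaussian curvature $K$ of this surface is constant if and only if $$f(u)=\frac{\sqrt G}{\alpha}\cos\phi(u),\qquad g(u)=\frac{\sqrt G}{\beta}\sin\phi(u),$$ where $\phi(u)$ are solutions of the equation $$G\left(\frac{\sin^2\phi}{\alpha^2}+\frac{\cos^2\phi}{\beta^2}\right)(\phi')^2+2G\sin\phi\cos\phi\left(\frac{1}{\beta^2}-\frac{1}{\alpha^2}\right)\phi'+\frac{(G')^2}{4G}\left(\frac{\cos^2\phi}{\alpha^2}+\frac{\sin^2\phi}{\beta^2}\right)-1=0,$$ and $$G=\left(C_1e^{Cu}+C_2e^{-Cu}\right)^2\ \text{ if } K=-C^2,$$ $$G=\left(C_1\sin(Cu)+C_2\cos(Cu)\right)^2\ \text{ if } K=C^2,$$ $$G=\left(C_1u+C_2\right)^2\ \text{ if } K=0,$$ where $C,C_1,C_2$ are constants such that $G\neq0$.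
   Context: A general rotational surface whose meridians lie in two-dimensional planes in Euclidean $\mathbb R^4$ is defined as follows. Let $\alpha,\beta$ be positive constants (the rates of rotation), and let $r(u)=(f(u),0,g(u),0)$, $u\in I$, be a regular curve (the meridian) in the plane spanned by the first and third standard basis vectors, parametrized by arc-length, with $(f(u))^2+(g(u))^2\neq0$. The curve is rotated in the $(x_1,x_2)$-plane by the angle $\alpha v$ and in the $(x_3,x_4)$-plane by the angle $\beta v$, $v\in\mathbb R$, which gives the surface $X(u,v)=(f(u)\cos\alpha v,f(u)\sin\alpha v,g(u)\cos\beta v,g(u)\sin\beta v)$. Here $G=\langle X_v,X_v\rangle=\alpha^2f^2+\beta^2g^2$ is the coefficient of the first fundamental form of the surface, a function of $u$; primes denote derivatives with respect to $u$. The Gaussian curvature $K$ is that of the metric induced on the surface.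
   Formalization: In the equation for φ, the coefficient 2G of the term linear in φ' is corrected to G'; the printed form fails, e.g. for α=1, β=2 and the unit-speed ellipse with G=1, K=0. *)

theory Defs
  imports "HOL-Analysis.Analysis"
begin

section \<open>Gaussian curvature of a parametrized surface in Euclidean 4-space\<close>

text \<open>The parameter plane is \<open>real ^ 2\<close>; a point \<open>p\<close> has parameters \<open>u = p $ 1\<close> and \<open>v = p $ 2\<close>.\<close>

definition partial_deriv :: "'n::finite \<Rightarrow> (real ^ 'n \<Rightarrow> 'a::real_normed_vector) \<Rightarrow> real ^ 'n \<Rightarrow> 'a" where
  "partial_deriv i F p = vector_derivative (\<lambda>t. F (p + t *\<^sub>R axis i 1)) (at 0)"

definition first_fundamental_form :: "(real ^ 2 \<Rightarrow> real ^ 4) \<Rightarrow> real ^ 2 \<Rightarrow> real ^ 2 ^ 2" where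
  "first_fundamental_form X p = (\<chi> i j. partial_deriv i X p \<bullet> partial_deriv j X p)"

text \<open>\<open>christoffel h k i j\<close> is the symbol with upper index \<open>k\<close> and lower indices \<open>i\<close>, \<open>j\<close> of the
  Levi-Civita connection of the metric \<open>h\<close>.\<close>

definition christoffel :: "(real ^ 'n \<Rightarrow> real ^ 'n ^ 'n) \<Rightarrow> 'n::finite \<Rightarrow> 'n \<Rightarrow> 'n \<Rightarrow> real ^ 'n \<Rightarrow> real" where
  "christoffel h k i j p =
     (\<Sum>l\<in>UNIV. matrix_inv (h p) $ k $ l *
        (partial_deriv i (\<lambda>q. h q $ j $ l) p + partial_deriv j (\<lambda>q. h q $ i $ l) p
          - partial_deriv l (\<lambda>q. h q $ i $ j) p)) / 2"

text \<open>\<open>riemann_curvature h l k i j\<close> is the \<open>l\<close>-th component of \<open>R(e\<^sub>i, e\<^sub>j) e\<^sub>k\<close>, with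
  \<open>R(Y, Z) = D\<^sub>Y D\<^sub>Z - D\<^sub>Z D\<^sub>Y - D\<^bsub>[Y,Z]\<^esub>\<close> for the Levi-Civita connection \<open>D\<close>.\<close>

definition riemann_curvature ::
    "(real ^ 'n \<Rightarrow> real ^ 'n ^ 'n) \<Rightarrow> 'n::finite \<Rightarrow> 'n \<Rightarrow> 'n \<Rightarrow> 'n \<Rightarrow> real ^ 'n \<Rightarrow> real" where
  "riemann_curvature h l k i j p =
     partial_deriv i (christoffel h l j k) p - partial_deriv j (christoffel h l i k) p
     + (\<Sum>m\<in>UNIV. christoffel h l i m p * christoffel h m j k p
                  - christoffel h l j m p * christoffel h m i k p)"

text \<open>\<open>K = \<langle>R(e\<^sub>1, e\<^sub>2) e\<^sub>2, e\<^sub>1\<rangle> / det h\<close>; the sign is the one for which round spheres have \<open>K > 0\<close>.\<close>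

definition metric_gauss_curvature :: "(real ^ 2 \<Rightarrow> real ^ 2 ^ 2) \<Rightarrow> real ^ 2 \<Rightarrow> real" where
  "metric_gauss_curvature h p =
     (\<Sum>l\<in>UNIV. h p $ 1 $ l * riemann_curvature h l 2 1 2 p) / det (h p)"

definition gauss_curvature :: "(real ^ 2 \<Rightarrow> real ^ 4) \<Rightarrow> real ^ 2 \<Rightarrow> real" where
  "gauss_curvature X = metric_gauss_curvature (first_fundamental_form X)"


section \<open>General rotational surfaces with planar meridians\<close>

text \<open>The meridian \<open>r(u) = (f u, 0, g u, 0)\<close> over an open interval \<open>I\<close>. Two continuous
  derivatives are what the Gaussian curvature of the rotated surface requires.\<close>

definition C2_on :: "real set \<Rightarrow> (real \<Rightarrow> real) \<Rightarrow> bool" where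
  "C2_on I f \<longleftrightarrow> (\<forall>u\<in>I. f differentiable at u \<and> deriv f differentiable at u)
                \<and> continuous_on I (deriv (deriv f))"

definition arclength_meridian :: "real set \<Rightarrow> (real \<Rightarrow> real) \<Rightarrow> (real \<Rightarrow> real) \<Rightarrow> bool" where
  "arclength_meridian I f g \<longleftrightarrow>
     open I \<and> is_interval I \<and> I \<noteq> {} \<and> C2_on I f \<and> C2_on I g
     \<and> (\<forall>u\<in>I. (deriv f u)\<^sup>2 + (deriv g u)\<^sup>2 = 1)
     \<and> (\<forall>u\<in>I. (f u)\<^sup>2 + (g u)\<^sup>2 \<noteq> 0)"

definition rot_surface ::
    "real \<Rightarrow> real \<Rightarrow> (real \<Rightarrow> real) \<Rightarrow> (real \<Rightarrow> real) \<Rightarrow> real ^ 2 \<Rightarrow> real ^ 4" where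
  "rot_surface \<alpha> \<beta> f g p =
     vector [f (p $ 1) * cos (\<alpha> * p $ 2), f (p $ 1) * sin (\<alpha> * p $ 2),
             g (p $ 1) * cos (\<beta> * p $ 2), g (p $ 1) * sin (\<beta> * p $ 2)]"

definition rot_G :: "real \<Rightarrow> real \<Rightarrow> (real \<Rightarrow> real) \<Rightarrow> (real \<Rightarrow> real) \<Rightarrow> real \<Rightarrow> real" where
  "rot_G \<alpha> \<beta> f g u = \<alpha>\<^sup>2 * (f u)\<^sup>2 + \<beta>\<^sup>2 * (g u)\<^sup>2"

lemma vector_4_axis:
  "(vector [a, b, c, d] :: real ^ 4) = a *\<^sub>R axis 1 1 + b *\<^sub>R axis 2 1 + c *\<^sub>R axis 3 1 + d *\<^sub>R axis 4 1"
  by (simp add: vec_eq_iff forall_4 vector_def axis_def)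

lemma partial_deriv_2_rot_surface:
  "partial_deriv 2 (rot_surface \<alpha> \<beta> f g) p =
     vector [- \<alpha> * f (p $ 1) * sin (\<alpha> * p $ 2), \<alpha> * f (p $ 1) * cos (\<alpha> * p $ 2),
             - \<beta> * g (p $ 1) * sin (\<beta> * p $ 2), \<beta> * g (p $ 1) * cos (\<beta> * p $ 2)]"
  unfolding partial_deriv_def rot_surface_def vector_4_axis
  by (rule vector_derivative_at)
     (auto intro!: derivative_eq_intros simp: axis_def algebra_simps)

lemma rot_G_eq_inner:
  "first_fundamental_form (rot_surface \<alpha> \<beta> f g) p $ 2 $ 2 = rot_G \<alpha> \<beta> f g (p $ 1)"
proof -
  have "first_fundamental_form (rot_surface \<alpha> \<beta> f g) p $ 2 $ 2
        = \<alpha>\<^sup>2 * (f (p $ 1))\<^sup>2 * ((sin (\<alpha> * p $ 2))\<^sup>2 + (cos (\<alpha> * p $ 2))\<^sup>2)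
          + \<beta>\<^sup>2 * (g (p $ 1))\<^sup>2 * ((sin (\<beta> * p $ 2))\<^sup>2 + (cos (\<beta> * p $ 2))\<^sup>2)"
    by (simp add: first_fundamental_form_def partial_deriv_2_rot_surface inner_vec_def sum_4
        vector_def power2_eq_square algebra_simps
        del: sin_cos_squared_add sin_cos_squared_add2 sin_cos_squared_add3)
  then show ?thesis
    by (simp add: rot_G_def)
qed

text \<open>The equation for the angle \<open>\<phi>\<close> is \<open>(f')\<^sup>2 + (g')\<^sup>2 = 1\<close> rewritten for
  \<open>f = (\<surd>G / \<alpha>) cos \<phi>\<close>, \<open>g = (\<surd>G / \<beta>) sin \<phi>\<close>. The cross terms of this expansion give
  the coefficient \<open>G'\<close> in the term linear in \<open>\<phi>'\<close>. The form with \<open>2 G\<close> instead of \<open>G'\<close>,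
  which is found in print, is a misprint: if \<open>\<alpha> \<noteq> \<beta>\<close>, it already fails for the meridians
  with constant \<open>G\<close> (arcs of ellipses, \<open>K = 0\<close>).\<close>

definition angle_equation ::
    "real \<Rightarrow> real \<Rightarrow> (real \<Rightarrow> real) \<Rightarrow> (real \<Rightarrow> real) \<Rightarrow> real \<Rightarrow> bool" where
  "angle_equation \<alpha> \<beta> G \<phi> u \<longleftrightarrow>
     G u * ((sin (\<phi> u))\<^sup>2 / \<alpha>\<^sup>2 + (cos (\<phi> u))\<^sup>2 / \<beta>\<^sup>2) * (deriv \<phi> u)\<^sup>2
     + deriv G u * sin (\<phi> u) * cos (\<phi> u) * (1 / \<beta>\<^sup>2 - 1 / \<alpha>\<^sup>2) * deriv \<phi> u
     + (deriv G u)\<^sup>2 / (4 * G u) * ((cos (\<phi> u))\<^sup>2 / \<alpha>\<^sup>2 + (sin (\<phi> u))\<^sup>2 / \<beta>\<^sup>2) - 1 = 0"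

definition angle_representation ::
    "real set \<Rightarrow> real \<Rightarrow> real \<Rightarrow> (real \<Rightarrow> real) \<Rightarrow> (real \<Rightarrow> real) \<Rightarrow> (real \<Rightarrow> real) \<Rightarrow> (real \<Rightarrow> real) \<Rightarrow> bool"
  where
  "angle_representation I \<alpha> \<beta> G \<phi> f g \<longleftrightarrow>
     (\<forall>u\<in>I. f u = sqrt (G u) / \<alpha> * cos (\<phi> u) \<and> g u = sqrt (G u) / \<beta> * sin (\<phi> u)
           \<and> \<phi> differentiable at u \<and> angle_equation \<alpha> \<beta> G \<phi> u \<and> G u \<noteq> 0)"

end

theory Submission
  imports Defs
begin

text \<open>Since the meridian has unit speed and \<open>X\<^sub>u\<close>, \<open>X\<^sub>v\<close> are orthogonal, the induced metric is
  \<open>du\<^sup>2 + G(u) dv\<^sup>2\<close> (\<open>first_fundamental_form_rot_surface\<close>). If \<open>G = r\<^sup>2\<close>, its curvature is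
  \<open>- r'' / r\<close> (\<open>gauss_curvature_polar_metric\<close>). With \<open>r = \<surd>G\<close>, the condition \<open>K = k\<close> is thus the
  linear equation \<open>r'' = - k r\<close>, whose solutions on an interval are found from constants of
  motion (\<open>constant_curvature_ODE_solutions\<close>). Conversely, if \<open>G\<close> is the square of such a solution
  \<open>r\<close>, then the curvature formula applies to \<open>r\<close> itself, whatever its sign.

  The angle imposes no condition: a function \<open>\<phi>\<close> as required exists for every meridian,
  independently of the curvature. The point \<open>(\<alpha> f, \<beta> g) / \<surd>G\<close> moves on the unit circle and has a
  differentiable angle \<open>\<phi>\<close> (\<open>differentiable_angle_on_unit_circle\<close>), and the equation for \<open>\<phi>\<close> is the
  arc-length condition (\<open>angle_equation_of_arclength\<close>).\<close>

section \<open>Curvature of a rotationally symmetric metric\<close>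

text \<open>Partial derivatives of a function that depends on the first coordinate only. The equality is
  required only on the strip over \<open>I\<close>, since partial derivatives are local.\<close>

lemma partial_deriv_of_first_coordinate:
  fixes F :: "real ^ 2 \<Rightarrow> real"
  assumes "open I" "p $ 1 \<in> I" "\<And>q. q $ 1 \<in> I \<Longrightarrow> F q = w (q $ 1)"
    and "(w has_real_derivative d) (at (p $ 1))"
  shows "partial_deriv 1 F p = d" "partial_deriv 2 F p = 0"
proof -
  define S where "S = (\<lambda>t. p $ 1 + t) -` I"
  have S: "open S" "0 \<in> S"
    using assms(1,2) by (auto simp: S_def intro!: open_vimage continuous_intros)
  have w: "((\<lambda>t. w (p $ 1 + t)) has_vector_derivative d) (at 0)"
    using DERIV_shift[of w d 0 "p $ 1"] assms(4)
    by (simp add: has_real_derivative_iff_has_vector_derivative add.commute)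
  have "((\<lambda>t. F (p + t *\<^sub>R axis 1 1)) has_vector_derivative d) (at 0)"
    by (rule has_vector_derivative_transform_within_open[OF w S])
       (use assms(3) in \<open>auto simp: S_def axis_def\<close>)
  then show "partial_deriv 1 F p = d"
    unfolding partial_deriv_def by (rule vector_derivative_at)
  have "F (p + t *\<^sub>R axis 2 1) = w (p $ 1)" for t
    using assms(2,3) by (auto simp: axis_def)
  then show "partial_deriv 2 F p = 0"
    by (simp add: partial_deriv_def)
qed

text \<open>The metric \<open>du\<^sup>2 + r(u)\<^sup>2 dv\<^sup>2\<close>. Only \<open>r\<^sup>2\<close> enters, so \<open>r\<close> may be negative; the metric is
  nondegenerate where \<open>r\<close> does not vanish.\<close>

definition polar_metric :: "(real \<Rightarrow> real) \<Rightarrow> real ^ 2 \<Rightarrow> real ^ 2 ^ 2" where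
  "polar_metric r p = (\<chi> i j. if i = j then if i = 1 then 1 else (r (p $ 1))\<^sup>2 else 0)"

lemma matrix_inv_polar_metric:
  assumes "r (p $ 1) \<noteq> 0"
  shows "matrix_inv (polar_metric r p)
         = (\<chi> i j. if i = j then if i = 1 then 1 else 1 / (r (p $ 1))\<^sup>2 else 0)"
    (is "_ = ?B")
proof -
  let ?A = "polar_metric r p"
  have AB: "?A ** ?B = mat 1" and BA: "?B ** ?A = mat 1"
    using assms by (simp_all add: matrix_matrix_mult_def polar_metric_def mat_def vec_eq_iff
        forall_2 sum_2)
  then have "\<exists>B. ?A ** B = mat 1 \<and> B ** ?A = mat 1"
    by blast
  from someI_ex[OF this] have "?A ** matrix_inv ?A = mat 1"
    unfolding matrix_inv_def by simp
  then have "?B ** (?A ** matrix_inv ?A) = ?B"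
    by (simp only: matrix_mul_rid)
  then show ?thesis
    by (simp only: matrix_mul_assoc BA matrix_mul_lid)
qed

text \<open>The formula \<open>K = - r'' / r\<close>. The function \<open>r'\<close> is \<open>r1\<close>, and \<open>r''\<close> is needed only at the point
  under consideration. The only nonzero Christoffel symbols are \<open>- r r'\<close> (upper index \<open>1\<close>, lower
  indices \<open>2\<close>, \<open>2\<close>) and \<open>r' / r\<close> (upper index \<open>2\<close>, lower indices \<open>1\<close> and \<open>2\<close>).\<close>

lemma gauss_curvature_polar_metric:
  fixes h :: "real ^ 2 \<Rightarrow> real ^ 2 ^ 2"
  assumes I: "open I" "p $ 1 \<in> I"
    and h: "\<And>q. q $ 1 \<in> I \<Longrightarrow> h q = polar_metric r q"
    and r0: "\<And>u. u \<in> I \<Longrightarrow> r u \<noteq> 0"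
    and r1: "\<And>u. u \<in> I \<Longrightarrow> (r has_real_derivative r1 u) (at u)"
    and r2: "(r1 has_real_derivative r2) (at (p $ 1))"
  shows "metric_gauss_curvature h p = - r2 / r (p $ 1)"
proof -
  have const: "partial_deriv 1 (\<lambda>q. h q $ i $ j) q = 0" "partial_deriv 2 (\<lambda>q. h q $ i $ j) q = 0"
    if "q $ 1 \<in> I" "i \<noteq> j \<or> i = 1" for q i j
    by (rule partial_deriv_of_first_coordinate[OF I(1) that(1), of _ "\<lambda>_. if i = j then 1 else 0" 0];
        use that in \<open>force simp: h polar_metric_def\<close>)+
  have G: "((\<lambda>u. (r u)\<^sup>2) has_real_derivative 2 * r u * r1 u) (at u)" if "u \<in> I" for u
    using r1[OF that] by (auto intro!: derivative_eq_intros)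
  have h22: "partial_deriv 1 (\<lambda>q. h q $ 2 $ 2) q = 2 * r (q $ 1) * r1 (q $ 1)"
    "partial_deriv 2 (\<lambda>q. h q $ 2 $ 2) q = 0" if "q $ 1 \<in> I" for q
    by (rule partial_deriv_of_first_coordinate[OF I(1) that _ G[OF that]],
        simp add: h polar_metric_def)+
  have chr: "christoffel h 1 2 2 q = - (r (q $ 1) * r1 (q $ 1))"
    "christoffel h 1 1 2 q = 0" "christoffel h 1 1 1 q = 0" "christoffel h 1 2 1 q = 0"
    "christoffel h 2 1 2 q = r1 (q $ 1) / r (q $ 1)" "christoffel h 2 2 2 q = 0"
    if q: "q $ 1 \<in> I" for q
    using r0[OF q]
    by (simp_all add: christoffel_def sum_2 h[OF q] matrix_inv_polar_metric const[OF q] h22[OF q]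
        field_simps power2_eq_square)
  have "((\<lambda>u. - (r u * r1 u)) has_real_derivative
      - ((r1 (p $ 1))\<^sup>2 + r (p $ 1) * r2)) (at (p $ 1))"
    using r1[OF I(2)] r2 by (auto intro!: derivative_eq_intros simp: power2_eq_square)
  then have d122: "partial_deriv 1 (christoffel h 1 2 2) p = - ((r1 (p $ 1))\<^sup>2 + r (p $ 1) * r2)"
    by (intro partial_deriv_of_first_coordinate(1)[OF I]) (auto simp: chr)
  have d112: "partial_deriv 2 (christoffel h 1 1 2) p = 0"
    by (rule partial_deriv_of_first_coordinate(2)[OF I, of _ "\<lambda>_. 0" 0]) (auto simp: chr)
  have "riemann_curvature h 1 2 1 2 p = - (r (p $ 1) * r2)"
    using r0[OF I(2)]
    by (simp add: riemann_curvature_def sum_2 d122 d112 chr[OF I(2)] power2_eq_square field_simps)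
  then show ?thesis
    using r0[OF I(2)]
    by (simp add: metric_gauss_curvature_def sum_2 h[OF I(2)] polar_metric_def det_2 field_simps
        power2_eq_square)
qed


section \<open>The induced metric of a general rotational surface\<close>

lemma partial_deriv_1_rot_surface:
  assumes "(f has_real_derivative f1) (at (p $ 1))" "(g has_real_derivative g1) (at (p $ 1))"
  shows "partial_deriv 1 (rot_surface \<alpha> \<beta> f g) p =
     vector [f1 * cos (\<alpha> * p $ 2), f1 * sin (\<alpha> * p $ 2),
             g1 * cos (\<beta> * p $ 2), g1 * sin (\<beta> * p $ 2)]"
proof -
  have shift: "((\<lambda>t. w (t + p $ 1)) has_real_derivative w1) (at 0)"
    if "(w has_real_derivative w1) (at (p $ 1))" for w w1
    using DERIV_shift[of w w1 0 "p $ 1"] that by simp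
  show ?thesis
    unfolding partial_deriv_def rot_surface_def vector_4_axis
    by (rule vector_derivative_at)
       (auto intro!: derivative_eq_intros simp: axis_def algebra_simps assms[THEN shift])
qed

lemma first_fundamental_form_rot_surface:
  assumes "(f has_real_derivative f1) (at (p $ 1))" "(g has_real_derivative g1) (at (p $ 1))"
    and "f1\<^sup>2 + g1\<^sup>2 = 1" and "(r (p $ 1))\<^sup>2 = rot_G \<alpha> \<beta> f g (p $ 1)"
  shows "first_fundamental_form (rot_surface \<alpha> \<beta> f g) p = polar_metric r p"
proof -
  let ?h = "first_fundamental_form (rot_surface \<alpha> \<beta> f g) p"
  note X = partial_deriv_1_rot_surface[OF assms(1,2)] partial_deriv_2_rot_surface
  have "?h $ 1 $ 1 = f1\<^sup>2 * ((sin (\<alpha> * p $ 2))\<^sup>2 + (cos (\<alpha> * p $ 2))\<^sup>2)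
          + g1\<^sup>2 * ((sin (\<beta> * p $ 2))\<^sup>2 + (cos (\<beta> * p $ 2))\<^sup>2)"
    by (simp add: first_fundamental_form_def X inner_vec_def sum_4 vector_def power2_eq_square
        algebra_simps del: sin_cos_squared_add sin_cos_squared_add2 sin_cos_squared_add3)
  then have "?h $ 1 $ 1 = 1"
    using assms(3) by simp
  moreover have "?h $ 1 $ 2 = 0" "?h $ 2 $ 1 = 0"
    by (simp_all add: first_fundamental_form_def X inner_vec_def sum_4 vector_def algebra_simps)
  moreover have "?h $ 2 $ 2 = (r (p $ 1))\<^sup>2"
    using assms(4) by (simp add: rot_G_eq_inner)
  ultimately show ?thesis
    by (simp add: vec_eq_iff forall_2 polar_metric_def)
qed

lemma arclength_meridianD:
  assumes "arclength_meridian I f g"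
  shows "open I" "convex I"
    and "\<And>u. u \<in> I \<Longrightarrow> (f has_real_derivative deriv f u) (at u)"
    and "\<And>u. u \<in> I \<Longrightarrow> (g has_real_derivative deriv g u) (at u)"
    and "\<And>u. u \<in> I \<Longrightarrow> (deriv f has_real_derivative deriv (deriv f) u) (at u)"
    and "\<And>u. u \<in> I \<Longrightarrow> (deriv g has_real_derivative deriv (deriv g) u) (at u)"
    and "\<And>u. u \<in> I \<Longrightarrow> (deriv f u)\<^sup>2 + (deriv g u)\<^sup>2 = 1"
    and "\<And>u. u \<in> I \<Longrightarrow> f u \<noteq> 0 \<or> g u \<noteq> 0"
  using assms unfolding arclength_meridian_def C2_on_def
  by (auto simp: is_interval_convex DERIV_deriv_iff_real_differentiable)

lemma rot_G_pos:
  assumes "\<alpha> > 0" "\<beta> > 0" "arclength_meridian I f g" "u \<in> I"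
  shows "rot_G \<alpha> \<beta> f g u > 0"
  using assms(1,2) arclength_meridianD(8)[OF assms(3,4)]
  by (auto simp: rot_G_def add_pos_nonneg add_nonneg_pos)

text \<open>Here \<open>r\<close> is any twice differentiable square root of \<open>G\<close>, not necessarily the positive one.\<close>

lemma gauss_curvature_rot_surface:
  assumes "\<alpha> > 0" "\<beta> > 0" and m: "arclength_meridian I f g" and p: "p $ 1 \<in> I"
    and r: "\<And>u. u \<in> I \<Longrightarrow> rot_G \<alpha> \<beta> f g u = (r u)\<^sup>2"
    and r1: "\<And>u. u \<in> I \<Longrightarrow> (r has_real_derivative r1 u) (at u)"
    and r2: "(r1 has_real_derivative r2) (at (p $ 1))"
  shows "gauss_curvature (rot_surface \<alpha> \<beta> f g) p = - r2 / r (p $ 1)"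
  unfolding gauss_curvature_def
proof (rule gauss_curvature_polar_metric[OF _ p _ _ r1 r2])
  show "open I"
    by (rule arclength_meridianD[OF m])
  show "first_fundamental_form (rot_surface \<alpha> \<beta> f g) q = polar_metric r q" if "q $ 1 \<in> I" for q
    by (rule first_fundamental_form_rot_surface; use arclength_meridianD[OF m] that r in auto)
  show "r u \<noteq> 0" if "u \<in> I" for u
    using rot_G_pos[OF assms(1-3) that] r[OF that] by auto
qed

lemma sqrt_rot_G_twice_differentiable:
  assumes "\<alpha> > 0" "\<beta> > 0" and m: "arclength_meridian I f g"
  obtains r1 r2 where
    "\<And>u. u \<in> I \<Longrightarrow> ((\<lambda>u. sqrt (rot_G \<alpha> \<beta> f g u)) has_real_derivative r1 u) (at u)"
    "\<And>u. u \<in> I \<Longrightarrow> (r1 has_real_derivative r2 u) (at u)"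
proof -
  note D = arclength_meridianD[OF m]
  define G where "G = rot_G \<alpha> \<beta> f g"
  define G1 where "G1 = (\<lambda>u. 2 * \<alpha>\<^sup>2 * f u * deriv f u + 2 * \<beta>\<^sup>2 * g u * deriv g u)"
  have pos: "G u > 0" if "u \<in> I" for u
    using rot_G_pos[OF assms(1-3) that] by (simp add: G_def)
  have dG: "(G has_real_derivative G1 u) (at u)" if "u \<in> I" for u
    unfolding G_def rot_G_def G1_def
    by (auto intro!: derivative_eq_intros D(3-4)[OF that] simp: algebra_simps)
  have "\<exists>d. (G1 has_real_derivative d) (at u)" if "u \<in> I" for u
    unfolding G1_def by (rule exI, (rule D(3-6)[OF that] derivative_eq_intros refl)+)
  then obtain G2 where dG1: "\<And>u. u \<in> I \<Longrightarrow> (G1 has_real_derivative G2 u) (at u)"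
    by metis
  have ds: "((\<lambda>u. sqrt (G u)) has_real_derivative G1 u / (2 * sqrt (G u))) (at u)"
    if "u \<in> I" for u
    using pos[OF that] by (auto intro!: derivative_eq_intros dG[OF that] simp: field_simps)
  have "\<exists>d. ((\<lambda>u. G1 u / (2 * sqrt (G u))) has_real_derivative d) (at u)" if "u \<in> I" for u
    by (rule exI, rule DERIV_divide[OF dG1[OF that] DERIV_cmult[OF ds[OF that]]])
      (use pos[OF that] in simp)
  then obtain r2 where "\<And>u. u \<in> I \<Longrightarrow>
      ((\<lambda>u. G1 u / (2 * sqrt (G u))) has_real_derivative r2 u) (at u)"
    by metis
  with ds show ?thesis
    unfolding G_def by (rule that)
qed


section \<open>Constant curvature and the equation \<open>r'' = - k r\<close>\<close>

lemma derivative_zero_imp_constant: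
  fixes w :: "real \<Rightarrow> real"
  assumes "convex I" "\<And>u. u \<in> I \<Longrightarrow> (w has_real_derivative 0) (at u)"
  obtains c where "\<And>u. u \<in> I \<Longrightarrow> w u = c"
  using has_field_derivative_zero_constant[OF assms(1), of w] assms(2)
  by (metis has_field_derivative_at_within)

lemma constant_curvature_ODE_solutions:
  fixes r r1 :: "real \<Rightarrow> real"
  assumes I: "convex I"
    and r: "\<And>u. u \<in> I \<Longrightarrow> (r has_real_derivative r1 u) (at u)"
    and r1: "\<And>u. u \<in> I \<Longrightarrow> (r1 has_real_derivative - k * r u) (at u)"
  shows "\<exists>C C1 C2. k = - C\<^sup>2 \<and> (\<forall>u\<in>I. r u = C1 * exp (C * u) + C2 * exp (- C * u)) \<or>
                  k = C\<^sup>2 \<and> (\<forall>u\<in>I. r u = C1 * sin (C * u) + C2 * cos (C * u)) \<or>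
                  k = 0 \<and> (\<forall>u\<in>I. r u = C1 * u + C2)"
proof -
  \<comment> \<open>In each case, the constants of motion \<open>a\<close> and \<open>b\<close> are the coefficients \<open>C1\<close> and \<open>C2\<close>.\<close>
  consider "k = 0" | "k > 0" | "k < 0" by linarith
  then show ?thesis
  proof cases
    case 1
    obtain a where a: "\<And>u. u \<in> I \<Longrightarrow> r1 u = a"
      by (rule derivative_zero_imp_constant[OF I, of r1]) (use r1 1 in auto)
    obtain b where b: "\<And>u. u \<in> I \<Longrightarrow> r u - a * u = b"
      by (rule derivative_zero_imp_constant[OF I, of "\<lambda>u. r u - a * u"])
         (auto intro!: derivative_eq_intros r simp: a)
    have "\<forall>u\<in>I. r u = a * u + b"
      using b by (auto simp: algebra_simps)
    with 1 show ?thesis by blast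
  next
    case 2
    define C where "C = sqrt k"
    have C: "C \<noteq> 0" "k = C\<^sup>2" using 2 by (auto simp: C_def)
    obtain a where a: "\<And>u. u \<in> I \<Longrightarrow> r u * sin (C * u) + r1 u * cos (C * u) / C = a"
      by (rule derivative_zero_imp_constant[OF I,
            of "\<lambda>u. r u * sin (C * u) + r1 u * cos (C * u) / C"])
         (auto intro!: derivative_eq_intros r r1 simp: C field_simps power2_eq_square)
    obtain b where b: "\<And>u. u \<in> I \<Longrightarrow> r u * cos (C * u) - r1 u * sin (C * u) / C = b"
      by (rule derivative_zero_imp_constant[OF I,
            of "\<lambda>u. r u * cos (C * u) - r1 u * sin (C * u) / C"])
         (auto intro!: derivative_eq_intros r r1 simp: C field_simps power2_eq_square)
    have "r u = a * sin (C * u) + b * cos (C * u)" if "u \<in> I" for u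
    proof -
      have "a * sin (C * u) + b * cos (C * u) = r u * ((sin (C * u))\<^sup>2 + (cos (C * u))\<^sup>2)"
        unfolding a[OF that, symmetric] b[OF that, symmetric]
        by (simp add: algebra_simps power2_eq_square del: sin_cos_squared_add sin_cos_squared_add2
            sin_cos_squared_add3)
      then show ?thesis by simp
    qed
    with C show ?thesis by blast
  next
    case 3
    define C where "C = sqrt (- k)"
    have C: "C \<noteq> 0" "k = - C\<^sup>2" using 3 by (auto simp: C_def)
    obtain a where a: "\<And>u. u \<in> I \<Longrightarrow> (r u + r1 u / C) * exp (- C * u) / 2 = a"
      by (rule derivative_zero_imp_constant[OF I,
            of "\<lambda>u. (r u + r1 u / C) * exp (- C * u) / 2"])
         (auto intro!: derivative_eq_intros r r1 simp: C field_simps power2_eq_square)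
    obtain b where b: "\<And>u. u \<in> I \<Longrightarrow> (r u - r1 u / C) * exp (C * u) / 2 = b"
      by (rule derivative_zero_imp_constant[OF I,
            of "\<lambda>u. (r u - r1 u / C) * exp (C * u) / 2"])
         (auto intro!: derivative_eq_intros r r1 simp: C field_simps power2_eq_square)
    have "r u = a * exp (C * u) + b * exp (- C * u)" if "u \<in> I" for u
      unfolding a[OF that, symmetric] b[OF that, symmetric]
      by (simp add: exp_minus field_simps)
    with C show ?thesis by blast
  qed
qed

text \<open>The constant curvature \<open>k\<close> fixes the form of \<open>G\<close>, by the differential equation for \<open>r = \<surd>G\<close>.\<close>

lemma constant_curvature_imp_rot_G:
  assumes "\<alpha> > 0" "\<beta> > 0" and m: "arclength_meridian I f g"
    and K: "\<And>p. p $ 1 \<in> I \<Longrightarrow> gauss_curvature (rot_surface \<alpha> \<beta> f g) p = k"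
  shows "\<exists>C C1 C2.
    k = - C\<^sup>2 \<and> (\<forall>u\<in>I. rot_G \<alpha> \<beta> f g u = (C1 * exp (C * u) + C2 * exp (- C * u))\<^sup>2) \<or>
    k = C\<^sup>2 \<and> (\<forall>u\<in>I. rot_G \<alpha> \<beta> f g u = (C1 * sin (C * u) + C2 * cos (C * u))\<^sup>2) \<or>
    k = 0 \<and> (\<forall>u\<in>I. rot_G \<alpha> \<beta> f g u = (C1 * u + C2)\<^sup>2)"
proof -
  let ?r = "\<lambda>u. sqrt (rot_G \<alpha> \<beta> f g u)"
  obtain r1 r2 where r1: "\<And>u. u \<in> I \<Longrightarrow> (?r has_real_derivative r1 u) (at u)"
    and r2: "\<And>u. u \<in> I \<Longrightarrow> (r1 has_real_derivative r2 u) (at u)"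
    using sqrt_rot_G_twice_differentiable[OF assms(1-3)] by blast
  have pos: "rot_G \<alpha> \<beta> f g u > 0" if "u \<in> I" for u
    by (rule rot_G_pos[OF assms(1-3) that])
  have "r2 u = - k * ?r u" if u: "u \<in> I" for u
  proof -
    have "gauss_curvature (rot_surface \<alpha> \<beta> f g) (vector [u, 0]) = - r2 u / ?r u"
      using gauss_curvature_rot_surface[OF assms(1-3), of "vector [u, 0]" ?r r1 "r2 u"] u r1 r2 pos
      by (simp add: less_imp_le)
    then show ?thesis
      using K[of "vector [u, 0]"] u pos[OF u] by (simp add: field_simps)
  qed
  then have "\<And>u. u \<in> I \<Longrightarrow> (r1 has_real_derivative - k * ?r u) (at u)"
    using r2 by metis
  from constant_curvature_ODE_solutions[OF arclength_meridianD(2)[OF m] r1 this]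
  obtain C C1 C2 where
    "k = - C\<^sup>2 \<and> (\<forall>u\<in>I. ?r u = C1 * exp (C * u) + C2 * exp (- C * u)) \<or>
     k = C\<^sup>2 \<and> (\<forall>u\<in>I. ?r u = C1 * sin (C * u) + C2 * cos (C * u)) \<or>
     k = 0 \<and> (\<forall>u\<in>I. ?r u = C1 * u + C2)"
    by blast
  moreover have "rot_G \<alpha> \<beta> f g u = (?r u)\<^sup>2" if "u \<in> I" for u
    using pos[OF that] by simp
  ultimately show ?thesis
    by (intro exI[of _ C] exI[of _ C1] exI[of _ C2]) auto
qed

lemma rot_G_imp_constant_curvature:
  assumes "\<alpha> > 0" "\<beta> > 0" and m: "arclength_meridian I f g" and p: "p $ 1 \<in> I"
  shows "\<forall>u\<in>I. rot_G \<alpha> \<beta> f g u = (C1 * exp (C * u) + C2 * exp (- C * u))\<^sup>2 \<Longrightarrow>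
      gauss_curvature (rot_surface \<alpha> \<beta> f g) p = - C\<^sup>2"
    and "\<forall>u\<in>I. rot_G \<alpha> \<beta> f g u = (C1 * sin (C * u) + C2 * cos (C * u))\<^sup>2 \<Longrightarrow>
      gauss_curvature (rot_surface \<alpha> \<beta> f g) p = C\<^sup>2"
    and "\<forall>u\<in>I. rot_G \<alpha> \<beta> f g u = (C1 * u + C2)\<^sup>2 \<Longrightarrow>
      gauss_curvature (rot_surface \<alpha> \<beta> f g) p = 0"
proof -
  have K: "gauss_curvature (rot_surface \<alpha> \<beta> f g) p = k"
    if G: "\<forall>u\<in>I. rot_G \<alpha> \<beta> f g u = (r u)\<^sup>2"
      and dr: "\<And>u. (r has_real_derivative dr u) (at u)"
      and ddr: "\<And>u. (dr has_real_derivative - k * r u) (at u)" for r dr k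
  proof -
    have "r (p $ 1) \<noteq> 0"
      using rot_G_pos[OF assms] G p by auto
    then show ?thesis
      using gauss_curvature_rot_surface[OF assms, of r dr "- k * r (p $ 1)"] G dr ddr by simp
  qed
  show "gauss_curvature (rot_surface \<alpha> \<beta> f g) p = - C\<^sup>2"
    if "\<forall>u\<in>I. rot_G \<alpha> \<beta> f g u = (C1 * exp (C * u) + C2 * exp (- C * u))\<^sup>2"
    by (rule K[OF that, where dr = "\<lambda>u. C * C1 * exp (C * u) - C * C2 * exp (- C * u)"])
       (auto intro!: derivative_eq_intros simp: algebra_simps power2_eq_square)
  show "gauss_curvature (rot_surface \<alpha> \<beta> f g) p = C\<^sup>2"
    if "\<forall>u\<in>I. rot_G \<alpha> \<beta> f g u = (C1 * sin (C * u) + C2 * cos (C * u))\<^sup>2"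
    by (rule K[OF that, where dr = "\<lambda>u. C * C1 * cos (C * u) - C * C2 * sin (C * u)"])
       (auto intro!: derivative_eq_intros simp: algebra_simps power2_eq_square)
  show "gauss_curvature (rot_surface \<alpha> \<beta> f g) p = 0"
    if "\<forall>u\<in>I. rot_G \<alpha> \<beta> f g u = (C1 * u + C2)\<^sup>2"
    by (rule K[OF that, where dr = "\<lambda>_. C1"]) (auto intro!: derivative_eq_intros)
qed


section \<open>The angle along the meridian\<close>

text \<open>The angle is the imaginary part of a continuous logarithm of \<open>x + \<i> y\<close>. It is differentiable
  because, near each point, it differs by a constant from the principal argument of a quotient
  close to \<open>1\<close>.\<close>

lemma differentiable_angle_on_unit_circle:
  fixes x y :: "real \<Rightarrow> real"
  assumes I: "open I" "convex I"
    and x: "\<And>u. u \<in> I \<Longrightarrow> x differentiable at u" and y: "\<And>u. u \<in> I \<Longrightarrow> y differentiable at u"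
    and xy: "\<And>u. u \<in> I \<Longrightarrow> (x u)\<^sup>2 + (y u)\<^sup>2 = 1"
  obtains \<phi> :: "real \<Rightarrow> real"
  where "\<And>u. u \<in> I \<Longrightarrow> \<phi> differentiable at u \<and> x u = cos (\<phi> u) \<and> y u = sin (\<phi> u)"
proof -
  define z where "z = (\<lambda>u. complex_of_real (x u) + \<i> * complex_of_real (y u))"
  have z1: "cmod (z u) = 1" if "u \<in> I" for u
    using xy[OF that] by (simp add: z_def cmod_def)
  have xv: "\<exists>d. (x has_vector_derivative d) (at u)" and yv: "\<exists>d. (y has_vector_derivative d) (at u)"
    if "u \<in> I" for u
    using x[OF that] y[OF that] vector_derivative_works by blast+
  have dz: "\<exists>d. (z has_vector_derivative d) (at u)" if u: "u \<in> I" for u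
  proof -
    obtain a b where "(x has_vector_derivative a) (at u)" "(y has_vector_derivative b) (at u)"
      using xv[OF u] yv[OF u] by blast
    then have "(z has_vector_derivative (of_real a + \<i> * of_real b)) (at u)"
      unfolding z_def
      by (intro has_vector_derivative_add has_vector_derivative_mult_right
          has_vector_derivative_of_real)
         (simp_all add: has_real_derivative_iff_has_vector_derivative)
    then show ?thesis by blast
  qed
  have "continuous_on I z"
    using dz by (meson has_vector_derivative_continuous continuous_at_imp_continuous_on)
  then obtain L where L: "continuous_on I L" "\<And>u. u \<in> I \<Longrightarrow> z u = exp (L u)"
    using continuous_logarithm_on_contractible[of I z] convex_imp_contractible[OF I(2)] z1
    by (metis norm_zero zero_neq_one)
  have re: "Re (L u) = 0" if "u \<in> I" for u
    using z1[OF that] L(2)[OF that] by (simp add: norm_exp_eq_Re)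
  have "(\<lambda>u. Im (L u)) differentiable at u" if u: "u \<in> I" for u
  proof -
    obtain d where d: "(z has_vector_derivative d) (at u)"
      using dz[OF u] by blast
    have "z u \<noteq> 0" using z1[OF u] by auto
    have "isCont L u"
      using L(1) I(1) u continuous_on_eq_continuous_at by blast
    then have "((\<lambda>w. Im (L w) - Im (L u)) \<longlongrightarrow> 0) (at u)"
      using tendsto_Im[of L "L u" "at u"] by (simp add: isCont_def LIM_zero)
    \<comment> \<open>Within this range, the principal logarithm inverts the exponential function.\<close>
    then have "\<forall>\<^sub>F w in at u. \<bar>Im (L w) - Im (L u)\<bar> < pi"
      using tendstoD[of "\<lambda>w. Im (L w) - Im (L u)" 0 "at u" pi] by (simp add: dist_real_def)
    moreover have "\<forall>\<^sub>F w in at u. w \<in> I"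
      using I(1) u by (rule eventually_at_in_open')
    ultimately have near: "\<forall>\<^sub>F w in at u. Im (Ln (z w / z u)) + Im (L u) = Im (L w)"
    proof eventually_elim
      case (elim w)
      have "z w / z u = exp (L w - L u)"
        using L(2) elim u by (simp add: exp_diff)
      then show ?case
        using elim Ln_exp[of "L w - L u"] by (simp add: abs_less_iff)
    qed
    have "(Ln has_field_derivative inverse (z u / z u)) (at (z u / z u))"
      by (rule has_field_derivative_Ln) (use \<open>z u \<noteq> 0\<close> in \<open>auto simp: complex_nonpos_Reals_iff\<close>)
    moreover have "((\<lambda>w. z w / z u) has_vector_derivative d / z u) (at u)"
      using d by (rule has_vector_derivative_divide)
    ultimately have "((\<lambda>w. Ln (z w / z u)) has_vector_derivative d / z u * inverse (z u / z u)) (at u)"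
      using field_vector_diff_chain_at[of "\<lambda>w. z w / z u" "d / z u" u Ln]
      by (simp add: o_def)
    then have "((\<lambda>w. Im (Ln (z w / z u)) + Im (L u)) has_vector_derivative
        Im (d / z u * inverse (z u / z u)) + 0) (at u)"
      by (intro has_vector_derivative_add bounded_linear.has_vector_derivative[OF bounded_linear_Im]
          has_vector_derivative_const)
    then have "(\<lambda>w. Im (Ln (z w / z u)) + Im (L u)) differentiable at u"
      by (rule differentiableI_vector)
    then obtain D where D: "((\<lambda>w. Im (Ln (z w / z u)) + Im (L u)) has_derivative D) (at u)"
      unfolding differentiable_def by blast
    have "((\<lambda>u. Im (L u)) has_derivative D) (at u)"
      by (rule has_derivative_transform_eventually[OF D near]) (use \<open>z u \<noteq> 0\<close> in auto)
    then show ?thesis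
      unfolding differentiable_def by blast
  qed
  moreover have "x u = cos (Im (L u)) \<and> y u = sin (Im (L u))" if "u \<in> I" for u
  proof -
    have "x u = Re (z u)" "y u = Im (z u)"
      by (simp_all add: z_def)
    then show ?thesis
      using L(2)[OF that] re[OF that] by (simp add: Re_exp Im_exp)
  qed
  ultimately show ?thesis
    by (intro that[of "\<lambda>u. Im (L u)"]) blast
qed

lemma angle_equation_of_arclength:
  assumes "\<alpha> > 0" "\<beta> > 0" and I: "open I" "u \<in> I"
    and pos: "G u > 0" and G: "(G has_real_derivative G1) (at u)"
    and \<phi>: "\<phi> differentiable at u"
    and f: "\<And>w. w \<in> I \<Longrightarrow> f w = sqrt (G w) / \<alpha> * cos (\<phi> w)"
    and g: "\<And>w. w \<in> I \<Longrightarrow> g w = sqrt (G w) / \<beta> * sin (\<phi> w)"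
    and arclength: "(deriv f u)\<^sup>2 + (deriv g u)\<^sup>2 = 1"
  shows "angle_equation \<alpha> \<beta> G \<phi> u"
proof -
  define s c d where "s = sin (\<phi> u)" and "c = cos (\<phi> u)" and "d = deriv \<phi> u"
  define q where "q = sqrt (G u)"
  have q: "q > 0" "G u = q\<^sup>2" using pos by (auto simp: q_def)
  have d\<phi>: "(\<phi> has_real_derivative d) (at u)"
    using \<phi> by (simp add: d_def DERIV_deriv_iff_real_differentiable)
  have dq: "((\<lambda>w. sqrt (G w)) has_real_derivative G1 / (2 * q)) (at u)"
    using pos by (auto intro!: derivative_eq_intros G simp: q_def field_simps)
  have "((\<lambda>w. sqrt (G w) * cos (\<phi> w) / \<alpha>) has_real_derivative
      (G1 / (2 * q) * c - q * s * d) / \<alpha>) (at u)"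
    by (rule DERIV_cdivide, (rule dq d\<phi> derivative_eq_intros refl)+)
       (simp add: q_def s_def c_def)
  then have "(f has_real_derivative (G1 / (2 * q) * c - q * s * d) / \<alpha>) (at u)"
    by (rule has_field_derivative_transform_within_open[OF _ I]) (simp add: f)
  then have f': "deriv f u = (G1 / (2 * q) * c - q * s * d) / \<alpha>"
    by (rule DERIV_imp_deriv)
  have "((\<lambda>w. sqrt (G w) * sin (\<phi> w) / \<beta>) has_real_derivative
      (G1 / (2 * q) * s + q * c * d) / \<beta>) (at u)"
    by (rule DERIV_cdivide, (rule dq d\<phi> derivative_eq_intros refl)+)
       (simp add: q_def s_def c_def)
  then have "(g has_real_derivative (G1 / (2 * q) * s + q * c * d) / \<beta>) (at u)"
    by (rule has_field_derivative_transform_within_open[OF _ I]) (simp add: g)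
  then have g': "deriv g u = (G1 / (2 * q) * s + q * c * d) / \<beta>"
    by (rule DERIV_imp_deriv)
  have G': "deriv G u = G1"
    using G by (rule DERIV_imp_deriv)
  have "q\<^sup>2 * (s\<^sup>2 / \<alpha>\<^sup>2 + c\<^sup>2 / \<beta>\<^sup>2) * d\<^sup>2 + G1 * s * c * (1 / \<beta>\<^sup>2 - 1 / \<alpha>\<^sup>2) * d
      + G1\<^sup>2 / (4 * q\<^sup>2) * (c\<^sup>2 / \<alpha>\<^sup>2 + s\<^sup>2 / \<beta>\<^sup>2)
      = ((G1 / (2 * q) * c - q * s * d) / \<alpha>)\<^sup>2 + ((G1 / (2 * q) * s + q * c * d) / \<beta>)\<^sup>2"
    using q(1) assms(1,2) by (simp add: field_simps power2_eq_square)
  then show ?thesis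
    using arclength unfolding angle_equation_def f' g' G' q(2)
    by (simp flip: s_def c_def d_def)
qed

lemma angle_representation_exists:
  assumes "\<alpha> > 0" "\<beta> > 0" and m: "arclength_meridian I f g"
  shows "\<exists>\<phi>. angle_representation I \<alpha> \<beta> (rot_G \<alpha> \<beta> f g) \<phi> f g"
proof -
  note D = arclength_meridianD[OF m]
  define G where "G = rot_G \<alpha> \<beta> f g"
  have pos: "G u > 0" if "u \<in> I" for u
    using rot_G_pos[OF assms(1-3) that] by (simp add: G_def)
  have G': "(G has_real_derivative 2 * \<alpha>\<^sup>2 * f u * deriv f u + 2 * \<beta>\<^sup>2 * g u * deriv g u) (at u)"
    if "u \<in> I" for u
    unfolding G_def rot_G_def
    by (auto intro!: derivative_eq_intros D(3-4)[OF that] simp: algebra_simps)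
  have s: "(\<lambda>u. sqrt (G u)) differentiable at u" if "u \<in> I" for u
    using sqrt_rot_G_twice_differentiable[OF assms] that unfolding G_def
    by (metis real_differentiable_def)
  obtain \<phi> where \<phi>: "\<And>u. u \<in> I \<Longrightarrow> \<phi> differentiable at u \<and>
      \<alpha> * f u / sqrt (G u) = cos (\<phi> u) \<and> \<beta> * g u / sqrt (G u) = sin (\<phi> u)"
  proof (rule differentiable_angle_on_unit_circle[OF D(1,2)])
    fix u assume u: "u \<in> I"
    have fg: "f differentiable at u" "g differentiable at u"
      using D(3,4)[OF u] by (auto simp: real_differentiable_def)
    show "(\<lambda>u. \<alpha> * f u / sqrt (G u)) differentiable at u"
      "(\<lambda>u. \<beta> * g u / sqrt (G u)) differentiable at u"
      using pos[OF u] by (intro differentiable_divide differentiable_mult s[OF u] fg; simp)+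
    show "(\<alpha> * f u / sqrt (G u))\<^sup>2 + (\<beta> * g u / sqrt (G u))\<^sup>2 = 1"
      using pos[OF u]
      by (simp add: power_divide power_mult_distrib flip: add_divide_distrib)
         (simp add: G_def rot_G_def)
  qed blast
  have fg: "f u = sqrt (G u) / \<alpha> * cos (\<phi> u)" "g u = sqrt (G u) / \<beta> * sin (\<phi> u)"
    if "u \<in> I" for u
    using \<phi>[OF that] pos[OF that] assms(1,2) by (auto simp: field_simps)
  have "angle_representation I \<alpha> \<beta> G \<phi> f g"
    unfolding angle_representation_def
  proof (intro ballI conjI)
    fix u assume u: "u \<in> I"
    show "f u = sqrt (G u) / \<alpha> * cos (\<phi> u)" "g u = sqrt (G u) / \<beta> * sin (\<phi> u)"
      using fg[OF u] .
    show "\<phi> differentiable at u" using \<phi>[OF u] by simp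
    then show "angle_equation \<alpha> \<beta> G \<phi> u"
      using angle_equation_of_arclength[OF assms(1,2) D(1) u pos[OF u] G'[OF u] _ fg D(7)[OF u]]
      by simp
    show "G u \<noteq> 0" using pos[OF u] by simp
  qed
  then show ?thesis unfolding G_def by blast
qed


section \<open>The classification\<close>

theorem theorem3p3:
  fixes \<alpha> \<beta> :: real and I :: "real set" and f g :: "real \<Rightarrow> real"
  assumes "\<alpha> > 0" and "\<beta> > 0"
    and "arclength_meridian I f g"
  shows
    "(gauss_curvature (rot_surface \<alpha> \<beta> f g) constant_on {p. p $ 1 \<in> I} \<longleftrightarrow>
       (\<exists>\<phi> C C1 C2. angle_representation I \<alpha> \<beta> (rot_G \<alpha> \<beta> f g) \<phi> f g \<and>
          ((\<forall>u\<in>I. rot_G \<alpha> \<beta> f g u = (C1 * exp (C * u) + C2 * exp (- C * u))\<^sup>2) \<or>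
           (\<forall>u\<in>I. rot_G \<alpha> \<beta> f g u = (C1 * sin (C * u) + C2 * cos (C * u))\<^sup>2) \<or>
           (\<forall>u\<in>I. rot_G \<alpha> \<beta> f g u = (C1 * u + C2)\<^sup>2))))
     \<and>
     (\<forall>k. (\<forall>p. p $ 1 \<in> I \<longrightarrow> gauss_curvature (rot_surface \<alpha> \<beta> f g) p = k) \<longleftrightarrow>
       (\<exists>\<phi> C C1 C2. angle_representation I \<alpha> \<beta> (rot_G \<alpha> \<beta> f g) \<phi> f g \<and>
          (k = - C\<^sup>2 \<and> (\<forall>u\<in>I. rot_G \<alpha> \<beta> f g u = (C1 * exp (C * u) + C2 * exp (- C * u))\<^sup>2) \<or>
           k = C\<^sup>2 \<and> (\<forall>u\<in>I. rot_G \<alpha> \<beta> f g u = (C1 * sin (C * u) + C2 * cos (C * u))\<^sup>2) \<or>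
           k = 0 \<and> (\<forall>u\<in>I. rot_G \<alpha> \<beta> f g u = (C1 * u + C2)\<^sup>2))))"
proof -
  let ?K = "gauss_curvature (rot_surface \<alpha> \<beta> f g)"
  let ?G = "rot_G \<alpha> \<beta> f g"
  obtain \<phi> where \<phi>: "angle_representation I \<alpha> \<beta> ?G \<phi> f g"
    using angle_representation_exists[OF assms] by blast
  have forward: "\<exists>\<phi> C C1 C2. angle_representation I \<alpha> \<beta> ?G \<phi> f g \<and>
      (k = - C\<^sup>2 \<and> (\<forall>u\<in>I. ?G u = (C1 * exp (C * u) + C2 * exp (- C * u))\<^sup>2) \<or>
       k = C\<^sup>2 \<and> (\<forall>u\<in>I. ?G u = (C1 * sin (C * u) + C2 * cos (C * u))\<^sup>2) \<or>
       k = 0 \<and> (\<forall>u\<in>I. ?G u = (C1 * u + C2)\<^sup>2))"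
    if "\<forall>p. p $ 1 \<in> I \<longrightarrow> ?K p = k" for k
    using constant_curvature_imp_rot_G[OF assms, of k] that \<phi> by blast
  note backward = rot_G_imp_constant_curvature[OF assms]
  show ?thesis
  proof (intro conjI allI iffI)
    assume "?K constant_on {p. p $ 1 \<in> I}"
    then obtain k where "\<forall>p. p $ 1 \<in> I \<longrightarrow> ?K p = k"
      unfolding constant_on_def by blast
    from forward[OF this]
    show "\<exists>\<phi> C C1 C2. angle_representation I \<alpha> \<beta> ?G \<phi> f g \<and>
          ((\<forall>u\<in>I. ?G u = (C1 * exp (C * u) + C2 * exp (- C * u))\<^sup>2) \<or>
           (\<forall>u\<in>I. ?G u = (C1 * sin (C * u) + C2 * cos (C * u))\<^sup>2) \<or>
           (\<forall>u\<in>I. ?G u = (C1 * u + C2)\<^sup>2))"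
      by blast
  next
    assume "\<exists>\<phi> C C1 C2. angle_representation I \<alpha> \<beta> ?G \<phi> f g \<and>
          ((\<forall>u\<in>I. ?G u = (C1 * exp (C * u) + C2 * exp (- C * u))\<^sup>2) \<or>
           (\<forall>u\<in>I. ?G u = (C1 * sin (C * u) + C2 * cos (C * u))\<^sup>2) \<or>
           (\<forall>u\<in>I. ?G u = (C1 * u + C2)\<^sup>2))"
    then consider
        (exponential) C C1 C2 where "\<forall>u\<in>I. ?G u = (C1 * exp (C * u) + C2 * exp (- C * u))\<^sup>2"
      | (trigonometric) C C1 C2 where "\<forall>u\<in>I. ?G u = (C1 * sin (C * u) + C2 * cos (C * u))\<^sup>2"
      | (affine) C1 C2 where "\<forall>u\<in>I. ?G u = (C1 * u + C2)\<^sup>2"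
      by blast
    then have "\<exists>k. \<forall>p. p $ 1 \<in> I \<longrightarrow> ?K p = k"
    proof cases
      case exponential
      then show ?thesis using backward(1) by blast
    next
      case trigonometric
      then show ?thesis using backward(2) by blast
    next
      case affine
      then show ?thesis using backward(3) by blast
    qed
    then show "?K constant_on {p. p $ 1 \<in> I}"
      unfolding constant_on_def by blast
  next
    fix k p
    assume "\<exists>\<phi> C C1 C2. angle_representation I \<alpha> \<beta> ?G \<phi> f g \<and>
      (k = - C\<^sup>2 \<and> (\<forall>u\<in>I. ?G u = (C1 * exp (C * u) + C2 * exp (- C * u))\<^sup>2) \<or>
       k = C\<^sup>2 \<and> (\<forall>u\<in>I. ?G u = (C1 * sin (C * u) + C2 * cos (C * u))\<^sup>2) \<or>
       k = 0 \<and> (\<forall>u\<in>I. ?G u = (C1 * u + C2)\<^sup>2))"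
    then show "p $ 1 \<in> I \<longrightarrow> ?K p = k"
      using backward by blast
  qed (rule forward)
qed

end
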